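(* Let $F\colon\{0,1\}^V\to\mathbb{R}^E$ be a submodular transformation with $F(V)=\mathbf{0}$. Then there exist $\gamma\in\mathbb{R}_{\ge0}$ and a non-zero vector $\mathbf{z}\in\mathbb{R}^V$ with $\mathbf{z}\perp\mathbf{1}$ and $\gamma\mathbf{z}\in L_F(\mathbf{z})$. Furthermore, every such $\gamma$ and $\mathbf{z}$ satisfy $\gamma=R_F(\mathbf{z})$.
   Context: $F_e(S):=F(S)(e)$, each $F_e$ submodular. For $G\colon\{0,1\}^V\to\mathbb{R}$, $B(G)=\{\mathbf{x}:\sum_{v\in S}\mathbf{x}(v)\le G(S)\ \forall S,\ \sum_{v\in V}\mathbf{x}(v)=G(V)\}$, the Lovász extension is $g(\mathbf{x})=\max_{\mathbf{w}\in B(G)}\langle\mathbf{w},\mathbf{x}\rangle$, $\partial g(\mathbf{x})=\operatorname{argmax}_{\mathbf{w}\in B(G)}\langle\mathbf{w},\mathbf{x}\rangle$, and $f_e$ is the Lovász extension of $F_e$. $L_F(\mathbf{x})=\{\sum_{e\in E}\mathbf{w}_e\langle\mathbf{w}_e,\mathbf{x}\rangle:\mathbf{w}_e\in\partial f_e(\mathbf{x})\}$ and $R_F(\mathbf{x})=\sum_{e\in E}f_e(\mathbf{x})^2/\|\mathbf{x}\|_2^2$ for $\mathbf{x}\ne\mathbf{0}$. $\mathbf{1}$ is the all-ones vector.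
   Formalization: The formal theorem adds |V| ≥ 2 (otherwise no non-zero z ⊥ 1 exists) and F_e(∅) ≥ 0 for every e (otherwise B(F_e) is empty, so f_e is undefined and L_F(z) is empty). *)

theory Defs
  imports "HOL-Analysis.Analysis"
begin

text \<open>The cube \<open>{0,1}\<^sup>V\<close> is the type of subsets of the finite type \<^typ>\<open>'v\<close>; thus \<open>F(V)\<close> is
  \<open>F UNIV\<close>.\<close>

definition submodular :: "('v set \<Rightarrow> real) \<Rightarrow> bool" where
  "submodular G \<longleftrightarrow> (\<forall>S T. G (S \<union> T) + G (S \<inter> T) \<le> G S + G T)"

definition component :: "('v set \<Rightarrow> real ^ 'e) \<Rightarrow> 'e \<Rightarrow> 'v set \<Rightarrow> real" where
  "component F e = (\<lambda>S. F S $ e)"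

definition submodular_transformation :: "('v set \<Rightarrow> real ^ 'e) \<Rightarrow> bool" where
  "submodular_transformation F \<longleftrightarrow> (\<forall>e. submodular (component F e))"

definition base_polytope :: "('v::finite set \<Rightarrow> real) \<Rightarrow> (real ^ 'v) set" where
  "base_polytope G =
     {x. (\<forall>S. (\<Sum>v\<in>S. x $ v) \<le> G S) \<and> (\<Sum>v\<in>UNIV. x $ v) = G UNIV}"

text \<open>The maximum is a genuine one only if the base polytope is nonempty (it is always compact).
  The constraint for \<open>S = {}\<close> reads \<open>0 \<le> G {}\<close>, so for submodular \<open>G\<close> nonemptiness amounts to
  this inequality.\<close>

definition lovasz_extension :: "('v::finite set \<Rightarrow> real) \<Rightarrow> real ^ 'v \<Rightarrow> real" where
  "lovasz_extension G x = (GREATEST r. r \<in> (\<lambda>w. w \<bullet> x) ` base_polytope G)"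

definition lovasz_subdiff :: "('v::finite set \<Rightarrow> real) \<Rightarrow> real ^ 'v \<Rightarrow> (real ^ 'v) set" where
  "lovasz_subdiff G x = {w. is_arg_max (\<lambda>w. w \<bullet> x) (\<lambda>w. w \<in> base_polytope G) w}"

definition laplacian ::
    "('v::finite set \<Rightarrow> real ^ 'e::finite) \<Rightarrow> real ^ 'v \<Rightarrow> (real ^ 'v) set" where
  "laplacian F x =
     {(\<Sum>e\<in>UNIV. (w e \<bullet> x) *\<^sub>R w e) | w. \<forall>e. w e \<in> lovasz_subdiff (component F e) x}"

definition rayleigh_quotient ::
    "('v::finite set \<Rightarrow> real ^ 'e::finite) \<Rightarrow> real ^ 'v \<Rightarrow> real" where
  "rayleigh_quotient F x =
     (\<Sum>e\<in>UNIV. (lovasz_extension (component F e) x)\<^sup>2) / (norm x)\<^sup>2"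

end

theory Submission imports Defs begin

text \<open>Let \<open>z\<close> minimise \<open>Q = \<Sum>\<^sub>e f\<^sub>e\<^sup>2\<close> on the unit sphere of \<open>\<one>\<^sup>\<bottom>\<close>, with minimum \<open>\<gamma>\<close>. The functions
  \<open>f\<^sub>e\<^sup>2\<close> need not be convex where \<open>f\<^sub>e < 0\<close>, so first-order optimality is derived by separation:
  \<open>L\<^sub>F(z)\<close> is compact and convex, and if it misses \<open>\<gamma> z\<close>, there is a direction \<open>d\<close> with
  \<open>\<langle>y, d\<rangle> < \<gamma> \<langle>z, d\<rangle>\<close> for all \<open>y \<in> L\<^sub>F(z)\<close>. By Danskin's theorem the one-sided derivative of \<open>Q\<close>
  at \<open>z\<close> along \<open>d\<close> is \<open>2 \<langle>y, d\<rangle>\<close> for some \<open>y \<in> L\<^sub>F(z)\<close>, whatever the signs of the \<open>f\<^sub>e(z)\<close>. This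
  contradicts \<open>Q(x) \<ge> \<gamma> \<parallel>x\<parallel>\<^sup>2\<close> on \<open>\<one>\<^sup>\<bottom>\<close>. Since \<open>F(V) = 0\<close>, everything is orthogonal to \<open>\<one>\<close>, and
  \<open>d\<close> may be projected to \<open>\<one>\<^sup>\<bottom>\<close>. The value of \<open>\<gamma>\<close> comes from pairing \<open>\<gamma> z \<in> L\<^sub>F(z)\<close> with \<open>z\<close>.\<close>

section \<open>Support functions of compact sets\<close>

definition support_function :: "'a::euclidean_space set \<Rightarrow> 'a \<Rightarrow> real" where
  "support_function B x = (SUP w\<in>B. w \<bullet> x)"

lemma support_function_attained:
  assumes "compact B" "B \<noteq> {}"
  obtains w where "w \<in> B" "w \<bullet> x = support_function B x"
proof -
  obtain w where w: "w \<in> B" "\<forall>u\<in>B. u \<bullet> x \<le> w \<bullet> x"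
    using continuous_attains_sup[OF assms, of "\<lambda>w. w \<bullet> x"]
    by (auto simp: continuous_on_inner continuous_on_id)
  have "support_function B x = w \<bullet> x"
    unfolding support_function_def using w by (intro cSup_eq_maximum) auto
  with w that show ?thesis by simp
qed

lemma inner_le_support_function:
  assumes "compact B" "w \<in> B"
  shows "w \<bullet> x \<le> support_function B x"
proof -
  have "compact ((\<lambda>w. w \<bullet> x) ` B)"
    using assms by (intro compact_continuous_image continuous_intros)
  then show ?thesis
    unfolding support_function_def using assms
    by (intro cSup_upper) (auto intro: bounded_imp_bdd_above compact_imp_bounded)
qed

lemma support_function_scaleR:
  assumes "compact B" "B \<noteq> {}" "0 \<le> c"
  shows "support_function B (c *\<^sub>R x) = c * support_function B x"
proof (rule antisym)
  obtain w where w: "w \<in> B" "w \<bullet> (c *\<^sub>R x) = support_function B (c *\<^sub>R x)"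
    using support_function_attained[OF assms(1,2)] .
  have "c * (w \<bullet> x) \<le> c * support_function B x"
    using inner_le_support_function[OF assms(1) w(1)] assms(3) by (rule mult_left_mono)
  then show "support_function B (c *\<^sub>R x) \<le> c * support_function B x"
    using w(2) by simp
next
  obtain w where w: "w \<in> B" "w \<bullet> x = support_function B x"
    using support_function_attained[OF assms(1,2)] .
  show "c * support_function B x \<le> support_function B (c *\<^sub>R x)"
    using inner_le_support_function[OF assms(1) w(1), of "c *\<^sub>R x"] w(2) by simp
qed

text \<open>A maximiser at one point is a competitor at the other, so a norm bound on
  \<open>B\<close> is a Lipschitz constant.\<close>

lemma continuous_on_support_function:
  assumes "compact B" "B \<noteq> {}"
  shows "continuous_on S (support_function B)"
proof -
  obtain C where C: "\<And>w. w \<in> B \<Longrightarrow> norm w \<le> C" "0 \<le> C"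
    using compact_imp_bounded[OF assms(1)] unfolding bounded_pos by (metis less_imp_le)
  have le: "support_function B x - support_function B y \<le> C * dist x y" for x y
  proof -
    obtain w where w: "w \<in> B" "w \<bullet> x = support_function B x"
      using support_function_attained[OF assms] .
    have "support_function B x - support_function B y \<le> w \<bullet> (x - y)"
      using inner_le_support_function[OF assms(1) w(1), of y] w(2) by (simp add: inner_diff_right)
    also have "\<dots> \<le> norm w * norm (x - y)"
      by (rule norm_cauchy_schwarz)
    also have "\<dots> \<le> C * dist x y"
      using C(1)[OF w(1)] by (simp add: dist_norm mult_right_mono)
    finally show ?thesis .
  qed
  have "C-lipschitz_on S (support_function B)"
    using C(2) le by (intro lipschitz_onI) (simp_all add: dist_real_def abs_le_iff, metis dist_commute)
  then show ?thesis
    by (rule lipschitz_on_continuous_on)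
qed

text \<open>Danskin's theorem: the derivative is realised by the maximisers at \<open>z\<close> that are extremal
  in the direction \<open>d\<close>.\<close>

lemma support_function_directional_derivative:
  assumes "compact B" "B \<noteq> {}"
  obtains w where "w \<in> B" "w \<bullet> z = support_function B z"
    "((\<lambda>t. (support_function B (z + t *\<^sub>R d) - support_function B z) / t) \<longlongrightarrow> w \<bullet> d) (at_right 0)"
proof -
  let ?\<sigma> = "support_function B"
  let ?face = "B \<inter> {u. u \<bullet> z = ?\<sigma> z}"
  have "closed {u. u \<bullet> z = ?\<sigma> z}"
    by (intro closed_Collect_eq continuous_intros)
  then have "compact ?face"
    using assms(1) by (rule compact_Int_closed[rotated])
  moreover have "?face \<noteq> {}"
    using support_function_attained[OF assms, of z] by auto
  ultimately obtain w where w: "w \<in> ?face" "w \<bullet> d = support_function ?face d"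
    by (rule support_function_attained)
  have wmax: "u \<bullet> d \<le> w \<bullet> d" if "u \<in> ?face" for u
    using inner_le_support_function[OF \<open>compact ?face\<close> that] w(2) by simp
  obtain C where C: "\<And>u. u \<in> B \<Longrightarrow> norm u \<le> C" "0 < C"
    using compact_imp_bounded[OF assms(1)] unfolding bounded_pos by blast
  \<comment> \<open>Since \<open>w\<close> lies in \<open>B\<close> and attains the value at
    \<open>z\<close>, testing it at the shifted point gives this bound for every positive
    \<open>t\<close>.\<close>
  have lower: "w \<bullet> d \<le> (?\<sigma> (z + t *\<^sub>R d) - ?\<sigma> z) / t" if "t > 0" for t
    using inner_le_support_function[OF assms(1), of w "z + t *\<^sub>R d"] w that
    by (simp add: field_simps inner_add_right)
  have upper: "\<forall>\<^sub>F t in at_right 0. (?\<sigma> (z + t *\<^sub>R d) - ?\<sigma> z) / t < b" if b: "w \<bullet> d < b" for b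
  proof -
    \<comment> \<open>The points of \<open>B\<close> that are too steep along \<open>d\<close> miss
      the face of maximisers at \<open>z\<close>. By compactness they fall short of the maximum at
      \<open>z\<close> by a uniform gap \<open>m\<close>.\<close>
    let ?K = "B \<inter> {u. b \<le> u \<bullet> d}"
    have "closed {u. b \<le> u \<bullet> d}"
      by (intro closed_Collect_le continuous_intros)
    then have K: "compact ?K"
      using assms(1) by (rule compact_Int_closed[rotated])
    have "\<exists>m>0. \<forall>u\<in>?K. u \<bullet> z \<le> ?\<sigma> z - m"
    proof (cases "?K = {}")
      case True
      then show ?thesis by (intro exI[of _ 1]) auto
    next
      case False
      then obtain k where k: "k \<in> ?K" "k \<bullet> z = support_function ?K z"
        using support_function_attained[OF K] by metis
      have "k \<notin> ?face"
        using wmax[of k] b k(1) by auto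
      then have "k \<bullet> z < ?\<sigma> z"
        using inner_le_support_function[OF assms(1), of k z] k(1) by auto
      moreover have "u \<bullet> z \<le> k \<bullet> z" if "u \<in> ?K" for u
        using inner_le_support_function[OF K that] k(2) by simp
      ultimately show ?thesis
        by (intro exI[of _ "?\<sigma> z - k \<bullet> z"]) auto
    qed
    then obtain m where m: "m > 0" "\<And>u. u \<in> ?K \<Longrightarrow> u \<bullet> z \<le> ?\<sigma> z - m"
      by blast
    \<comment> \<open>\<open>D\<close> strictly exceeds the variation of the product with
      \<open>d\<close> over \<open>B\<close>; the summand 1 keeps it positive even for
      \<open>d = 0\<close>. For \<open>t < m / D\<close> a perturbation along \<open>d\<close>
      cannot make up for the gap \<open>m\<close>.\<close>
    define D where "D = 2 * C * norm d + 1"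
    have D: "D > 0" using C(2) by (simp add: D_def add_nonneg_pos)
    have "\<forall>\<^sub>F t in at_right 0. t \<in> {0<..<m / D}"
      using m(1) D by (intro eventually_at_rightI[of _ "m / D"]) auto
    then show ?thesis
    proof (rule eventually_mono)
      fix t assume t: "t \<in> {0<..<m / D}"
      obtain u where u: "u \<in> B" "u \<bullet> (z + t *\<^sub>R d) = ?\<sigma> (z + t *\<^sub>R d)"
        using support_function_attained[OF assms] .
      have "(u - w) \<bullet> d \<le> norm (u - w) * norm d"
        by (rule norm_cauchy_schwarz)
      also have "\<dots> \<le> (2 * C) * norm d"
        using C(1)[OF u(1)] C(1)[of w] w(1) norm_triangle_ineq4[of u w]
        by (intro mult_right_mono) auto
      also have "\<dots> < D" by (simp add: D_def)
      finally have "t * ((u - w) \<bullet> d) < t * D"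
        using t by simp
      also have "\<dots> < m"
        using t D by (simp add: field_simps)
      finally have "t * (u \<bullet> d) - t * (w \<bullet> d) < m"
        by (simp add: inner_diff_left algebra_simps)
      moreover have "?\<sigma> z + t * (w \<bullet> d) \<le> u \<bullet> z + t * (u \<bullet> d)"
        using inner_le_support_function[OF assms(1), of w "z + t *\<^sub>R d"] w(1) u(2)
        by (simp add: inner_add_right)
      \<comment> \<open>The maximiser \<open>u\<close> at the shifted point loses less than
        \<open>m\<close> at \<open>z\<close>, so it lies outside \<open>?K\<close>. Testing this
        \<open>u\<close> at \<open>z\<close> then bounds the quotient from above.\<close>
      ultimately have "\<not> u \<bullet> z \<le> ?\<sigma> z - m" by linarith
      then have "u \<bullet> d < b"
        using m(2)[of u] u(1) by force
      moreover have "(?\<sigma> (z + t *\<^sub>R d) - ?\<sigma> z) / t \<le> u \<bullet> d"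
        using inner_le_support_function[OF assms(1) u(1), of z] u(2)[symmetric] t
        by (simp add: field_simps inner_add_right)
      ultimately show "(?\<sigma> (z + t *\<^sub>R d) - ?\<sigma> z) / t < b" by linarith
    qed
  qed
  have "((\<lambda>t. (?\<sigma> (z + t *\<^sub>R d) - ?\<sigma> z) / t) \<longlongrightarrow> w \<bullet> d) (at_right 0)"
  proof (rule order_tendstoI)
    fix a assume a: "a < w \<bullet> d"
    show "\<forall>\<^sub>F t in at_right 0. a < (?\<sigma> (z + t *\<^sub>R d) - ?\<sigma> z) / t"
      using eventually_at_right_less[of 0]
      by (rule eventually_mono) (use lower a in \<open>force intro: less_le_trans\<close>)
  qed (rule upper)
  then show ?thesis
    using that[of w] w(1) by auto
qed

text \<open>These sums form a Minkowski sum, so splitting off one index reduces both properties to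
  the sum of two sets.\<close>

lemma compact_convex_sum_selections:
  fixes S :: "'e \<Rightarrow> 'a::real_normed_vector set"
  assumes "finite A" "\<And>e. e \<in> A \<Longrightarrow> compact (S e)" "\<And>e. e \<in> A \<Longrightarrow> convex (S e)"
  shows "compact {\<Sum>e\<in>A. w e | w. \<forall>e\<in>A. w e \<in> S e} \<and>
         convex {\<Sum>e\<in>A. w e | w. \<forall>e\<in>A. w e \<in> S e}"
  using assms
proof (induction A rule: finite_induct)
  case empty
  then show ?case by simp
next
  case (insert a A)
  let ?P = "{\<Sum>e\<in>A. w e | w. \<forall>e\<in>A. w e \<in> S e}"
  have "{\<Sum>e\<in>insert a A. w e | w. \<forall>e\<in>insert a A. w e \<in> S e} = {x + y | x y. x \<in> S a \<and> y \<in> ?P}"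
    (is "?L = ?R")
  proof
    show "?L \<subseteq> ?R"
      using insert.hyps by auto
    show "?R \<subseteq> ?L"
    proof
      fix s assume "s \<in> ?R"
      then obtain x w where s: "s = x + (\<Sum>e\<in>A. w e)" "x \<in> S a" "\<forall>e\<in>A. w e \<in> S e"
        by blast
      have "(\<Sum>e\<in>A. (w(a := x)) e) = (\<Sum>e\<in>A. w e)"
        using insert.hyps by (intro sum.cong) auto
      then have "s = (\<Sum>e\<in>insert a A. (w(a := x)) e)"
        using s(1) insert.hyps by simp
      moreover have "\<forall>e\<in>insert a A. (w(a := x)) e \<in> S e"
        using s by simp
      ultimately show "s \<in> ?L" by blast
    qed
  qed
  moreover have "{x + y | x y. x \<in> S a \<and> y \<in> ?P} = (\<Union>x\<in>S a. \<Union>y\<in>?P. {x + y})"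
    by blast
  ultimately show ?case
    using compact_sums[of "S a" ?P] convex_sums[of "S a" ?P] insert by simp
qed

section \<open>The base polytope\<close>

text \<open>Edmonds' greedy construction: elements are added one at a time, and each receives its
  marginal gain as coordinate.\<close>

lemma greedy_base:
  fixes G :: "'v set \<Rightarrow> real"
  assumes "finite A" "submodular G" "G {} = 0"
  shows "\<exists>x. (\<forall>S\<subseteq>A. sum x S \<le> G S) \<and> sum x A = G A"
  using assms(1)
proof (induction A rule: finite_induct)
  case empty
  then show ?case using assms(3) by simp
next
  case (insert a A)
  then obtain x where x: "\<And>S. S \<subseteq> A \<Longrightarrow> sum x S \<le> G S" "sum x A = G A" by blast
  define y where "y = x(a := G (insert a A) - G A)"
  have yx: "sum y S = sum x S" if "S \<subseteq> A" for S
    unfolding y_def using that insert.hyps by (intro sum.cong) auto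
  have "sum y S \<le> G S" if S: "S \<subseteq> insert a A" for S
  proof (cases "a \<in> S")
    case False
    then have "S \<subseteq> A" using S by blast
    then show ?thesis using x yx by simp
  next
    case True
    define T where "T = S - {a}"
    have T: "S = insert a T" "a \<notin> T" "T \<subseteq> A" "finite T"
      using True S insert.hyps by (auto simp: T_def intro: finite_subset)
    \<comment> \<open>Submodularity for \<open>S\<close> and \<open>A\<close> expresses diminishing
      returns: the gain of \<open>a\<close> over \<open>A\<close> is at most its gain over the
      smaller set \<open>T\<close>.\<close>
    have "S \<union> A = insert a A" "S \<inter> A = T"
      using T insert.hyps by auto
    then have "G (insert a A) + G T \<le> G S + G A"
      using assms(2) unfolding submodular_def by metis
    moreover have "sum y S = G (insert a A) - G A + sum x T"
      using T yx[OF T(3)] by (simp add: y_def)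
    ultimately show ?thesis
      using x(1)[OF T(3)] by linarith
  qed
  moreover have "sum y (insert a A) = G (insert a A)"
    using insert.hyps x(2) yx[of A] by (simp add: y_def)
  ultimately show ?case by blast
qed

lemma base_polytope_nonempty:
  fixes G :: "'v::finite set \<Rightarrow> real"
  assumes "submodular G" "0 \<le> G {}"
  shows "base_polytope G \<noteq> {}"
proof -
  \<comment> \<open>The greedy construction needs the value 0 at the empty set. Lowering
    \<open>G\<close> there only tightens the constraints.\<close>
  define H where "H = G({} := 0)"
  have "H (S \<union> T) + H (S \<inter> T) \<le> H S + H T" for S T
  proof (cases "S = {} \<or> T = {}")
    case True
    then show ?thesis by auto
  next
    \<comment> \<open>For nonempty \<open>S\<close> and \<open>T\<close>, only the intersection term
      can change, and it only decreases.\<close>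
    case False
    moreover have "G (S \<union> T) + G (S \<inter> T) \<le> G S + G T"
      using assms(1) by (simp add: submodular_def)
    ultimately show ?thesis
      using assms(2) by (auto simp: H_def)
  qed
  then have "submodular H" by (simp add: submodular_def)
  then obtain x where x: "\<And>S. sum x S \<le> H S" "sum x UNIV = H UNIV"
    using greedy_base[of UNIV H] by (auto simp: H_def)
  have "H S \<le> G S" for S
    using assms(2) by (simp add: H_def)
  then have "(\<chi> v. x v) \<in> base_polytope G"
    using x unfolding base_polytope_def by (auto simp: H_def intro: order_trans)
  then show ?thesis by blast
qed

lemma compact_base_polytope: "compact (base_polytope G)"
  for G :: "'v::finite set \<Rightarrow> real"
proof -
  have "base_polytope G =
      (\<Inter>S. {x. (\<Sum>v\<in>S. x $ v) \<le> G S}) \<inter> {x. (\<Sum>v\<in>UNIV. x $ v) = G UNIV}"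
    by (auto simp: base_polytope_def)
  moreover have "closed \<dots>"
    by (intro closed_Int closed_INT ballI closed_Collect_le closed_Collect_eq continuous_intros)
  ultimately have "closed (base_polytope G)" by simp
  \<comment> \<open>Singletons bound the coordinates from above; their complements, together with
    the fixed total, bound them from below.\<close>
  moreover have "base_polytope G \<subseteq> cbox (\<chi> v. G UNIV - G (UNIV - {v})) (\<chi> v. G {v})"
  proof
    fix x assume x: "x \<in> base_polytope G"
    have "G UNIV - G (UNIV - {v}) \<le> x $ v \<and> x $ v \<le> G {v}" for v
    proof -
      have le: "(\<Sum>v\<in>S. x $ v) \<le> G S" for S
        using x by (simp add: base_polytope_def)
      have "G UNIV = x $ v + (\<Sum>u\<in>UNIV - {v}. x $ u)"
        using x by (simp add: base_polytope_def sum.remove[of UNIV v])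
      then show ?thesis
        using le[of "{v}"] le[of "UNIV - {v}"] by simp
    qed
    then show "x \<in> cbox (\<chi> v. G UNIV - G (UNIV - {v})) (\<chi> v. G {v})"
      by (simp add: mem_box_cart)
  qed
  then have "bounded (base_polytope G)"
    by (rule bounded_subset[OF bounded_cbox])
  ultimately show ?thesis
    by (simp add: compact_eq_bounded_closed)
qed

lemma convex_base_polytope: "convex (base_polytope G)"
  for G :: "'v::finite set \<Rightarrow> real"
proof (rule convexI)
  fix x y :: "real ^ 'v" and a b :: real
  assume xy: "x \<in> base_polytope G" "y \<in> base_polytope G" and ab: "0 \<le> a" "0 \<le> b" "a + b = 1"
  have sum_eq: "(\<Sum>v\<in>S. (a *\<^sub>R x + b *\<^sub>R y) $ v) = a * (\<Sum>v\<in>S. x $ v) + b * (\<Sum>v\<in>S. y $ v)" for S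
    by (simp add: sum.distrib sum_distrib_left)
  have "a * (\<Sum>v\<in>S. x $ v) + b * (\<Sum>v\<in>S. y $ v) \<le> G S" for S
    using xy ab by (intro convex_bound_le) (auto simp: base_polytope_def)
  moreover have "a * G UNIV + b * G UNIV = G UNIV"
    using ab(3) by (metis distrib_right mult_1)
  ultimately show "a *\<^sub>R x + b *\<^sub>R y \<in> base_polytope G"
    using xy sum_eq unfolding base_polytope_def by auto
qed

lemma inner_one_base_polytope:
  fixes G :: "'v::finite set \<Rightarrow> real"
  assumes "w \<in> base_polytope G"
  shows "w \<bullet> 1 = G UNIV"
  using assms by (simp add: base_polytope_def inner_vec_def)

section \<open>Lovasz extensions, their subdifferentials and the Laplacian\<close>

lemma lovasz_extension_eq_support_function:
  assumes "base_polytope G \<noteq> {}"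
  shows "lovasz_extension G x = support_function (base_polytope G) x"
proof -
  obtain w where w: "w \<in> base_polytope G" "w \<bullet> x = support_function (base_polytope G) x"
    using support_function_attained[OF compact_base_polytope assms] .
  \<comment> \<open>\<open>GREATEST\<close> can be evaluated here because the maximum is
    attained.\<close>
  show ?thesis
    unfolding lovasz_extension_def
    using w inner_le_support_function[OF compact_base_polytope]
    by (intro Greatest_equality) force+
qed

lemma mem_lovasz_subdiff_iff:
  assumes "base_polytope G \<noteq> {}"
  shows "w \<in> lovasz_subdiff G x \<longleftrightarrow> w \<in> base_polytope G \<and> w \<bullet> x = lovasz_extension G x"
proof -
  obtain u where u: "u \<in> base_polytope G" "u \<bullet> x = support_function (base_polytope G) x"
    using support_function_attained[OF compact_base_polytope assms] .
  show ?thesis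
    unfolding lovasz_subdiff_def is_arg_max_linorder lovasz_extension_eq_support_function[OF assms]
    using u inner_le_support_function[OF compact_base_polytope[of G], of _ x]
    by (auto intro: antisym) (metis antisym)
qed

text \<open>All members of a subdifferential at \<open>x\<close> have the same product with
  \<open>x\<close>, so the coefficient \<open>w e \<bullet> x\<close> is the constant
  \<open>?f e\<close>. The seemingly quadratic set is therefore a Minkowski sum of scaled faces of
  base polytopes.\<close>

lemma compact_convex_laplacian:
  fixes F :: "'v::finite set \<Rightarrow> real ^ 'e::finite"
  assumes "\<And>e. base_polytope (component F e) \<noteq> {}"
  shows "compact (laplacian F x) \<and> convex (laplacian F x)"
proof -
  let ?f = "\<lambda>e. lovasz_extension (component F e) x"
  let ?D = "\<lambda>e. lovasz_subdiff (component F e) x"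
  have D: "?D e = base_polytope (component F e) \<inter> {w. w \<bullet> x = ?f e}" for e
    using mem_lovasz_subdiff_iff[OF assms] by blast
  have "closed {w. w \<bullet> x = ?f e}" for e
    by (intro closed_Collect_eq continuous_intros)
  then have "compact (?D e)" for e
    unfolding D by (intro compact_Int_closed compact_base_polytope)
  moreover have "convex {w. w \<bullet> x = ?f e}" for e
    using convex_hyperplane[of x "?f e"] by (simp add: inner_commute)
  then have "convex (?D e)" for e
    unfolding D by (intro convex_Int convex_base_polytope)
  ultimately have "compact {\<Sum>e\<in>UNIV. u e | u. \<forall>e\<in>UNIV. u e \<in> (*\<^sub>R) (?f e) ` ?D e} \<and>
      convex {\<Sum>e\<in>UNIV. u e | u. \<forall>e\<in>UNIV. u e \<in> (*\<^sub>R) (?f e) ` ?D e}" (is "compact ?L \<and> _")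
    by (intro compact_convex_sum_selections compact_scaling convex_scaling) auto
  moreover have "laplacian F x = ?L"
  proof
    show "laplacian F x \<subseteq> ?L"
    proof
      fix y assume "y \<in> laplacian F x"
      then obtain w where w: "y = (\<Sum>e\<in>UNIV. (w e \<bullet> x) *\<^sub>R w e)" "\<forall>e. w e \<in> ?D e"
        unfolding laplacian_def by blast
      then have "\<forall>e\<in>UNIV. (w e \<bullet> x) *\<^sub>R w e \<in> (*\<^sub>R) (?f e) ` ?D e"
        using D by fastforce
      with w(1) show "y \<in> ?L" by blast
    qed
    show "?L \<subseteq> laplacian F x"
    proof
      fix y assume "y \<in> ?L"
      then obtain u where u: "y = (\<Sum>e\<in>UNIV. u e)" "\<forall>e. u e \<in> (*\<^sub>R) (?f e) ` ?D e"
        by blast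
      then obtain w where w: "\<And>e. w e \<in> ?D e" "\<And>e. u e = ?f e *\<^sub>R w e"
        unfolding image_iff by metis
      have "u e = (w e \<bullet> x) *\<^sub>R w e" for e
        using w D by auto
      then show "y \<in> laplacian F x"
        unfolding laplacian_def using u(1) w(1) by auto
    qed
  qed
  ultimately show ?thesis by simp
qed

lemma eigenvalue_eq_rayleigh_quotient:
  fixes F :: "'v::finite set \<Rightarrow> real ^ 'e::finite"
  assumes "\<And>e. base_polytope (component F e) \<noteq> {}" "z \<noteq> 0" "\<gamma> *\<^sub>R z \<in> laplacian F z"
  shows "\<gamma> = rayleigh_quotient F z"
proof -
  obtain w where w: "\<gamma> *\<^sub>R z = (\<Sum>e\<in>UNIV. (w e \<bullet> z) *\<^sub>R w e)"
    "\<And>e. w e \<in> lovasz_subdiff (component F e) z"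
    using assms(3) unfolding laplacian_def by blast
  have f: "w e \<bullet> z = lovasz_extension (component F e) z" for e
    using w(2)[of e] mem_lovasz_subdiff_iff[OF assms(1)] by blast
  have "\<gamma> * (norm z)\<^sup>2 = (\<gamma> *\<^sub>R z) \<bullet> z"
    by (simp add: power2_norm_eq_inner)
  also have "\<dots> = (\<Sum>e\<in>UNIV. (lovasz_extension (component F e) z)\<^sup>2)"
    unfolding w(1) by (simp add: inner_sum_left f power2_eq_square)
  finally show ?thesis
    using assms(2) by (simp add: rayleigh_quotient_def field_simps)
qed

section \<open>Minimisers of the Rayleigh quotient\<close>

lemma exists_unit_vector_orthogonal_one:
  assumes "CARD('v::finite) \<ge> 2"
  shows "\<exists>x :: real ^ 'v. norm x = 1 \<and> x \<bullet> 1 = 0"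
proof -
  have "\<not> CARD('v) \<le> Suc 0"
    using assms by simp
  then obtain a b :: 'v where "a \<noteq> b"
    using card_le_Suc0_iff_eq[of "UNIV :: 'v set"] by auto
  define y :: "real ^ 'v" where "y = axis a 1 - axis b 1"
  have "y \<noteq> 0"
    using \<open>a \<noteq> b\<close> by (auto simp: y_def axis_eq_axis)
  moreover have "y \<bullet> 1 = 0"
    by (simp add: y_def inner_diff_left inner_axis')
  ultimately show ?thesis
    by (intro exI[of _ "y /\<^sub>R norm y"]) simp
qed

text \<open>The sum of squares is homogeneous of degree 2, so a minimum over the compact unit sphere
  of the complement of 1 gives the bound on the whole complement. Two coordinates make that sphere
  nonempty.\<close>

lemma exists_rayleigh_minimiser:
  fixes f :: "'e::finite \<Rightarrow> real ^ 'v::finite \<Rightarrow> real"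
  assumes "CARD('v) \<ge> 2"
    and cont: "\<And>e. continuous_on UNIV (f e)"
    and hom: "\<And>e c x. 0 \<le> c \<Longrightarrow> f e (c *\<^sub>R x) = c * f e x"
  obtains z where "norm z = 1" "z \<bullet> 1 = 0"
    "\<And>x. x \<bullet> 1 = 0 \<Longrightarrow> (\<Sum>e\<in>UNIV. (f e z)\<^sup>2) * (norm x)\<^sup>2 \<le> (\<Sum>e\<in>UNIV. (f e x)\<^sup>2)"
proof -
  let ?Q = "\<lambda>x. \<Sum>e\<in>UNIV. (f e x)\<^sup>2"
  let ?S = "sphere 0 1 \<inter> {x :: real ^ 'v. x \<bullet> 1 = 0}"
  have "closed {x :: real ^ 'v. x \<bullet> 1 = 0}"
    by (intro closed_Collect_eq continuous_intros)
  then have "compact ?S"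
    by (intro compact_Int_closed compact_sphere)
  moreover have "?S \<noteq> {}"
    using exists_unit_vector_orthogonal_one[OF assms(1)] by auto
  moreover have "continuous_on ?S ?Q"
    by (intro continuous_intros continuous_on_subset[OF cont]) auto
  ultimately obtain z where z: "z \<in> ?S" "\<And>y. y \<in> ?S \<Longrightarrow> ?Q z \<le> ?Q y"
    using continuous_attains_inf[of ?S ?Q] by blast
  have "?Q z * (norm x)\<^sup>2 \<le> ?Q x" if "x \<bullet> 1 = 0" for x
  proof (cases "x = 0")
    case True
    then show ?thesis by (simp add: sum_nonneg)
  next
    case False
    then have "?Q z \<le> ?Q (x /\<^sub>R norm x)"
      using that by (intro z(2)) auto
    also have "\<dots> = ?Q x / (norm x)\<^sup>2"
      using hom[of "inverse (norm x)"]
      by (simp add: power_mult_distrib sum_divide_distrib field_simps)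
    finally show ?thesis
      using False by (simp add: field_simps)
  qed
  then show ?thesis
    using that[of z] z(1) by simp
qed

lemma eigenvector_of_rayleigh_minimiser:
  fixes F :: "'v::finite set \<Rightarrow> real ^ 'e::finite"
  assumes ne: "\<And>e. base_polytope (component F e) \<noteq> {}"
    and F: "F UNIV = 0"
    and z: "norm z = 1" "z \<bullet> 1 = 0"
    and \<gamma>: "\<gamma> = (\<Sum>e\<in>UNIV. (lovasz_extension (component F e) z)\<^sup>2)"
    and min: "\<And>x. x \<bullet> 1 = 0 \<Longrightarrow>
      \<gamma> * (norm x)\<^sup>2 \<le> (\<Sum>e\<in>UNIV. (lovasz_extension (component F e) x)\<^sup>2)"
  shows "\<gamma> *\<^sub>R z \<in> laplacian F z"
proof (rule ccontr)
  let ?f = "\<lambda>e. lovasz_extension (component F e)"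
  let ?B = "\<lambda>e. base_polytope (component F e)"
  have f: "?f e = support_function (?B e)" for e
    using lovasz_extension_eq_support_function[OF ne] by blast
  assume "\<gamma> *\<^sub>R z \<notin> laplacian F z"
  moreover have "closed (laplacian F z)" "convex (laplacian F z)"
    using compact_convex_laplacian[OF ne] compact_imp_closed by blast+
  ultimately obtain a b where sep: "a \<bullet> (\<gamma> *\<^sub>R z) < b" "\<And>y. y \<in> laplacian F z \<Longrightarrow> b < a \<bullet> y"
    using separating_hyperplane_closed_point[of "laplacian F z" "\<gamma> *\<^sub>R z"] by auto
  \<comment> \<open>\<open>d\<close> is the orthogonal projection of \<open>-a\<close> to the
    complement of 1. The sign turns the separation into a direction of descent.\<close>
  define d :: "real ^ 'v" where "d = ((a \<bullet> 1) / (1 \<bullet> (1 :: real ^ 'v))) *\<^sub>R 1 - a"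
  have "(1 :: real ^ 'v) \<bullet> 1 \<noteq> 0"
    by simp
  then have d1: "d \<bullet> 1 = 0"
    by (simp add: d_def inner_diff_left)
  have dy: "y \<bullet> d = - (a \<bullet> y)" if "y \<bullet> 1 = 0" for y
    using that by (simp add: d_def inner_diff_right inner_commute)
  have "\<forall>e. \<exists>w. w \<in> ?B e \<and> w \<bullet> z = ?f e z \<and>
      ((\<lambda>t. (?f e (z + t *\<^sub>R d) - ?f e z) / t) \<longlongrightarrow> w \<bullet> d) (at_right 0)"
    unfolding f
  proof
    fix e
    obtain w where "w \<in> ?B e" "w \<bullet> z = support_function (?B e) z"
      "((\<lambda>t. (support_function (?B e) (z + t *\<^sub>R d) - support_function (?B e) z) / t)
        \<longlongrightarrow> w \<bullet> d) (at_right 0)"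
      using support_function_directional_derivative[OF compact_base_polytope ne[of e]] .
    then show "\<exists>w. w \<in> ?B e \<and> w \<bullet> z = support_function (?B e) z \<and>
      ((\<lambda>t. (support_function (?B e) (z + t *\<^sub>R d) - support_function (?B e) z) / t)
        \<longlongrightarrow> w \<bullet> d) (at_right 0)"
      by (intro exI conjI)
  qed
  from choice[OF this] obtain w where w: "\<And>e. w e \<in> ?B e" "\<And>e. w e \<bullet> z = ?f e z"
    "\<And>e. ((\<lambda>t. (?f e (z + t *\<^sub>R d) - ?f e z) / t) \<longlongrightarrow> w e \<bullet> d) (at_right 0)"
    by blast
  define y where "y = (\<Sum>e\<in>UNIV. (w e \<bullet> z) *\<^sub>R w e)"
  have y: "y \<in> laplacian F z"
    unfolding laplacian_def y_def using w mem_lovasz_subdiff_iff[OF ne] by blast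
  \<comment> \<open>The coordinates of a base sum to the value of the component at
    \<open>UNIV\<close>, which is 0.\<close>
  have "w e \<bullet> 1 = 0" for e
    using inner_one_base_polytope[OF w(1)] F by (simp add: component_def)
  then have y1: "y \<bullet> 1 = 0"
    by (simp add: y_def inner_sum_left)
  have tz: "((\<lambda>t. z + t *\<^sub>R d) \<longlongrightarrow> z) (at_right 0)"
    by (auto intro!: tendsto_eq_intros)
  have lim_f: "((\<lambda>t. ?f e (z + t *\<^sub>R d)) \<longlongrightarrow> ?f e z) (at_right 0)" for e
    using continuous_on_tendsto_compose[OF
        continuous_on_support_function[OF compact_base_polytope ne, of UNIV] tz]
    unfolding f by simp
  \<comment> \<open>Factoring each difference of squares gives the derivative of a square without
    any sign condition on \<open>?f e z\<close>; the limit is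
    \<open>2 * (y \<bullet> d)\<close>.\<close>
  have "((\<lambda>t. \<Sum>e\<in>UNIV. (?f e (z + t *\<^sub>R d) - ?f e z) / t * (?f e (z + t *\<^sub>R d) + ?f e z))
      \<longlongrightarrow> (\<Sum>e\<in>UNIV. (w e \<bullet> d) * (?f e z + ?f e z))) (at_right 0)"
    by (intro tendsto_intros w(3) lim_f)
  moreover have "((\<lambda>t. \<gamma> * (2 * (z \<bullet> d) + t * (d \<bullet> d))) \<longlongrightarrow> \<gamma> * (2 * (z \<bullet> d))) (at_right 0)"
    by (auto intro!: tendsto_eq_intros)
  moreover have "\<forall>\<^sub>F t in at_right 0. \<gamma> * (2 * (z \<bullet> d) + t * (d \<bullet> d)) \<le>
      (\<Sum>e\<in>UNIV. (?f e (z + t *\<^sub>R d) - ?f e z) / t * (?f e (z + t *\<^sub>R d) + ?f e z))"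
    using eventually_at_right_less[of 0]
  proof (rule eventually_mono)
    fix t :: real assume t: "0 < t"
    \<comment> \<open>As \<open>z\<close> has norm 1, subtracting the value at \<open>z\<close> from
      the minimality inequality leaves a factor \<open>t\<close> on both sides, which
      cancels.\<close>
    have n: "(norm (z + t *\<^sub>R d))\<^sup>2 = 1 + t * (2 * (z \<bullet> d) + t * (d \<bullet> d))"
      using z(1) unfolding power2_norm_eq_inner norm_eq_1
      by (simp add: inner_add_left inner_add_right inner_commute algebra_simps)
    have "\<gamma> * (norm (z + t *\<^sub>R d))\<^sup>2 \<le> (\<Sum>e\<in>UNIV. (?f e (z + t *\<^sub>R d))\<^sup>2)"
      using z(2) d1 by (intro min) (simp add: inner_add_left)
    then have "t * (\<gamma> * (2 * (z \<bullet> d) + t * (d \<bullet> d))) \<le>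
        (\<Sum>e\<in>UNIV. (?f e (z + t *\<^sub>R d))\<^sup>2 - (?f e z)\<^sup>2)"
      unfolding n sum_subtractf \<gamma>[symmetric] by (simp add: algebra_simps)
    also have "\<dots> = t * (\<Sum>e\<in>UNIV. (?f e (z + t *\<^sub>R d) - ?f e z) / t * (?f e (z + t *\<^sub>R d) + ?f e z))"
      unfolding sum_distrib_left using t
      by (intro sum.cong) (simp_all add: power2_eq_square square_diff_square_factored mult.commute)
    finally show "\<gamma> * (2 * (z \<bullet> d) + t * (d \<bullet> d)) \<le>
        (\<Sum>e\<in>UNIV. (?f e (z + t *\<^sub>R d) - ?f e z) / t * (?f e (z + t *\<^sub>R d) + ?f e z))"
      using t by simp
  qed
  ultimately have "\<gamma> * (2 * (z \<bullet> d)) \<le> (\<Sum>e\<in>UNIV. (w e \<bullet> d) * (?f e z + ?f e z))"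
    by (intro tendsto_le[OF trivial_limit_at_right_real])
  also have "\<dots> = 2 * (y \<bullet> d)"
    by (simp add: y_def inner_sum_left w(2) sum_distrib_left algebra_simps)
  finally have "\<gamma> * (z \<bullet> d) \<le> y \<bullet> d" by simp
  then have "a \<bullet> y \<le> a \<bullet> (\<gamma> *\<^sub>R z)"
    using dy[OF y1] dy[OF z(2)] by simp
  with sep(1) sep(2)[OF y] show False by linarith
qed

theorem theorem3p3:
  fixes F :: "'v::finite set \<Rightarrow> real ^ 'e::finite"
  assumes "CARD('v) \<ge> 2"
    and "submodular_transformation F"
    and "\<And>e. 0 \<le> component F e {}"
    and "F UNIV = 0"
  shows "(\<exists>(\<gamma>::real) (z::real ^ 'v).
            \<gamma> \<ge> 0 \<and> z \<noteq> 0 \<and> orthogonal z 1 \<and> \<gamma> *\<^sub>R z \<in> laplacian F z) \<and>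
         (\<forall>(\<gamma>::real) (z::real ^ 'v).
            \<gamma> \<ge> 0 \<and> z \<noteq> 0 \<and> orthogonal z 1 \<and> \<gamma> *\<^sub>R z \<in> laplacian F z \<longrightarrow>
            \<gamma> = rayleigh_quotient F z)"
proof -
  let ?f = "\<lambda>e. lovasz_extension (component F e)"
  \<comment> \<open>Nonnegativity at the empty set is what makes the maxima defining the Lovasz
    extensions exist.\<close>
  have ne: "base_polytope (component F e) \<noteq> {}" for e
    using assms(2,3) by (intro base_polytope_nonempty) (auto simp: submodular_transformation_def)
  have f: "?f e = support_function (base_polytope (component F e))" for e
    using lovasz_extension_eq_support_function[OF ne] by blast
  obtain z where z: "norm z = 1" "z \<bullet> 1 = 0"
    "\<And>x. x \<bullet> 1 = 0 \<Longrightarrow> (\<Sum>e\<in>UNIV. (?f e z)\<^sup>2) * (norm x)\<^sup>2 \<le> (\<Sum>e\<in>UNIV. (?f e x)\<^sup>2)"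
    using exists_rayleigh_minimiser[OF assms(1), of ?f] unfolding f
    using continuous_on_support_function[OF compact_base_polytope ne]
      support_function_scaleR[OF compact_base_polytope ne] by metis
  let ?\<gamma> = "\<Sum>e\<in>UNIV. (?f e z)\<^sup>2"
  have "?\<gamma> *\<^sub>R z \<in> laplacian F z"
    using eigenvector_of_rayleigh_minimiser[OF ne assms(4) z(1,2) refl z(3)] .
  moreover have "?\<gamma> \<ge> 0" "z \<noteq> 0" "orthogonal z 1"
    using z(1,2) by (auto simp: sum_nonneg orthogonal_def)
  ultimately show ?thesis
    using eigenvalue_eq_rayleigh_quotient[OF ne] by blast
qed

end
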